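(* Let $k\ge1$ and let $\Lambda$ be a row-finite $k$-graph with no sources. Suppose that $\Lambda$ is cofinal and contains a cycle $\lambda$ (an element with $s(\lambda)=r(\lambda)$) satisfying $d(\lambda)\ge(1,\dots,1)$. Then either $S(\Lambda)$ is stably finite and totally ordered, or $S(\Lambda)$ is purely infinite and $x\le y$ for any nonzero $x,y\in S(\Lambda)$.
   Context: $\mathbb{N}=\{0,1,2,\dots\}$; $\mathbb{N}^k$ has the coordinatewise order. A $k$-graph is a nonempty countable small category $\Lambda$ with a functor $d\colon\Lambda\to\mathbb{N}^k$ such that whenever $d(\lambda)=m+n$ there are unique $\mu,\nu\in\Lambda$ with $d(\mu)=m$, $d(\nu)=n$, $\lambda=\mu\nu$. $\Lambda^n=d^{-1}(n)$; $\Lambda^0$ is the set of vertices (identity morphisms); $r(\lambda),s(\lambda)\in\Lambda^0$ are the codomain and domain of $\lambda$. $v\Lambda=\{\lambda:r(\lambda)=v\}$, $v\Lambda^n=v\Lambda\cap\Lambda^n$. $\Lambda$ is row-finite if every $v\Lambda^n$ is finite, has no sources if every $v\Lambda^n$ is nonempty, and is cofinal if for all $v,w\in\Lambda^0$ there is $n\in\mathbb{N}^k$ with $s(w\Lambda^n)\subseteq s(v\Lambda)$. The semigroup $S(\Lambda)$: let $\mathbb{N}\Lambda^0$ be the finitely supported functions $\Lambda^0\to\mathbb{N}$ with generators $\delta_v$, and for $n\in\mathbb{N}^k$ let $A_n^t\colon\mathbb{N}\Lambda^0\to\mathbb{N}\Lambda^0$ be the additive map $A_n^t\delta_v=\sum_{\lambda\in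 v\Lambda^n}\delta_{s(\lambda)}$. Write $x\sim_\Lambda y$ if $A_p^tx=A_q^ty$ for some $p,q\in\mathbb{N}^k$. Write $f\approx_\Lambda g$ if there are finitely many $x_i,y_i\in\mathbb{N}\Lambda^0$ with $f\sim_\Lambda\sum_ix_i$, $g\sim_\Lambda\sum_iy_i$ and $x_i\sim_\Lambda y_i$ for all $i$. Then $\approx_\Lambda$ is an equivalence relation and $S(\Lambda)=\mathbb{N}\Lambda^0/\!\approx_\Lambda$ is an abelian semigroup with identity under $[f]_\Lambda+[g]_\Lambda=[f+g]_\Lambda$, with the algebraic preorder ($a\le b$ iff $a+c=b$ for some $c$). In a preordered abelian semigroup $S$ with identity, a nonzero $x$ is infinite if $x+y=x$ for some nonzero $y\in S$, and properly infinite if $2x\le x$. $S$ is stably finite if it has no infinite elements, and purely infinite if every nonzero element is properly infinite. *)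

theory Defs
  imports "HOL-Analysis.Finite_Cartesian_Product" "HOL-Algebra.Group" "HOL-Library.Multiset"
    "HOL-Library.Countable_Set"
begin

text \<open>
  A small category is given by its set of morphisms only: objects are identified with their
  identity morphisms, so that \<open>rng\<close> (codomain) and \<open>src\<close> (domain) take values in \<open>mor\<close>.
  The composite \<open>\<mu>\<nu>\<close> is \<open>pcomp \<Lambda> \<mu> \<nu>\<close>,
  meaningful only when \<open>src \<Lambda> \<mu> = rng \<Lambda> \<nu>\<close>. The degree takes values in \<open>nat ^ 'k\<close>, with
  \<open>k = CARD('k)\<close>, which is at least 1.
\<close>

record ('a, 'k) kgraph_data =
  mor :: "'a set"
  pcomp :: "'a \<Rightarrow> 'a \<Rightarrow> 'a"
  rng :: "'a \<Rightarrow> 'a"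
  src :: "'a \<Rightarrow> 'a"
  deg :: "'a \<Rightarrow> nat ^ 'k"

locale small_category =
  fixes \<Lambda> :: "('a, 'k::finite) kgraph_data"
  assumes rng_closed: "\<alpha> \<in> mor \<Lambda> \<Longrightarrow> rng \<Lambda> \<alpha> \<in> mor \<Lambda>"
    and src_closed: "\<alpha> \<in> mor \<Lambda> \<Longrightarrow> src \<Lambda> \<alpha> \<in> mor \<Lambda>"
    and rng_rng: "\<alpha> \<in> mor \<Lambda> \<Longrightarrow> rng \<Lambda> (rng \<Lambda> \<alpha>) = rng \<Lambda> \<alpha>"
    and src_rng: "\<alpha> \<in> mor \<Lambda> \<Longrightarrow> src \<Lambda> (rng \<Lambda> \<alpha>) = rng \<Lambda> \<alpha>"
    and rng_src: "\<alpha> \<in> mor \<Lambda> \<Longrightarrow> rng \<Lambda> (src \<Lambda> \<alpha>) = src \<Lambda> \<alpha>"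
    and src_src: "\<alpha> \<in> mor \<Lambda> \<Longrightarrow> src \<Lambda> (src \<Lambda> \<alpha>) = src \<Lambda> \<alpha>"
    and pcomp_closed: "\<alpha> \<in> mor \<Lambda> \<Longrightarrow> \<mu> \<in> mor \<Lambda> \<Longrightarrow> src \<Lambda> \<alpha> = rng \<Lambda> \<mu> \<Longrightarrow> pcomp \<Lambda> \<alpha> \<mu> \<in> mor \<Lambda>"
    and rng_pcomp: "\<alpha> \<in> mor \<Lambda> \<Longrightarrow> \<mu> \<in> mor \<Lambda> \<Longrightarrow> src \<Lambda> \<alpha> = rng \<Lambda> \<mu> \<Longrightarrow> rng \<Lambda> (pcomp \<Lambda> \<alpha> \<mu>) = rng \<Lambda> \<alpha>"
    and src_pcomp: "\<alpha> \<in> mor \<Lambda> \<Longrightarrow> \<mu> \<in> mor \<Lambda> \<Longrightarrow> src \<Lambda> \<alpha> = rng \<Lambda> \<mu> \<Longrightarrow> src \<Lambda> (pcomp \<Lambda> \<alpha> \<mu>) = src \<Lambda> \<mu>"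
    and pcomp_assoc: "\<alpha> \<in> mor \<Lambda> \<Longrightarrow> \<mu> \<in> mor \<Lambda> \<Longrightarrow> \<nu> \<in> mor \<Lambda> \<Longrightarrow>
        src \<Lambda> \<alpha> = rng \<Lambda> \<mu> \<Longrightarrow> src \<Lambda> \<mu> = rng \<Lambda> \<nu> \<Longrightarrow>
        pcomp \<Lambda> (pcomp \<Lambda> \<alpha> \<mu>) \<nu> = pcomp \<Lambda> \<alpha> (pcomp \<Lambda> \<mu> \<nu>)"
    and rng_pcomp_id: "\<alpha> \<in> mor \<Lambda> \<Longrightarrow> pcomp \<Lambda> (rng \<Lambda> \<alpha>) \<alpha> = \<alpha>"
    and pcomp_src_id: "\<alpha> \<in> mor \<Lambda> \<Longrightarrow> pcomp \<Lambda> \<alpha> (src \<Lambda> \<alpha>) = \<alpha>"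

text \<open>
  The degree is a functor to the monoid \<open>nat ^ 'k\<close> viewed as a one-object category; the last
  axiom is the unique factorisation property.
\<close>

locale k_graph = small_category \<Lambda> for \<Lambda> :: "('a, 'k::finite) kgraph_data" +
  assumes mor_nonempty: "mor \<Lambda> \<noteq> {}"
    and mor_countable: "countable (mor \<Lambda>)"
    and deg_rng: "\<alpha> \<in> mor \<Lambda> \<Longrightarrow> deg \<Lambda> (rng \<Lambda> \<alpha>) = 0"
    and deg_src: "\<alpha> \<in> mor \<Lambda> \<Longrightarrow> deg \<Lambda> (src \<Lambda> \<alpha>) = 0"
    and deg_pcomp: "\<alpha> \<in> mor \<Lambda> \<Longrightarrow> \<mu> \<in> mor \<Lambda> \<Longrightarrow> src \<Lambda> \<alpha> = rng \<Lambda> \<mu> \<Longrightarrow>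
        deg \<Lambda> (pcomp \<Lambda> \<alpha> \<mu>) = deg \<Lambda> \<alpha> + deg \<Lambda> \<mu>"
    and factorisation: "\<alpha> \<in> mor \<Lambda> \<Longrightarrow> deg \<Lambda> \<alpha> = m + n \<Longrightarrow>
        \<exists>!(\<mu>, \<nu>). \<mu> \<in> mor \<Lambda> \<and> \<nu> \<in> mor \<Lambda> \<and> src \<Lambda> \<mu> = rng \<Lambda> \<nu> \<and>
          deg \<Lambda> \<mu> = m \<and> deg \<Lambda> \<nu> = n \<and> \<alpha> = pcomp \<Lambda> \<mu> \<nu>"

definition paths :: "('a, 'k::finite) kgraph_data \<Rightarrow> nat ^ 'k \<Rightarrow> 'a set" where
  "paths \<Lambda> n = {\<alpha> \<in> mor \<Lambda>. deg \<Lambda> \<alpha> = n}"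

definition vertices :: "('a, 'k::finite) kgraph_data \<Rightarrow> 'a set" where
  "vertices \<Lambda> = paths \<Lambda> 0"

definition mor_from :: "('a, 'k::finite) kgraph_data \<Rightarrow> 'a \<Rightarrow> 'a set" where
  "mor_from \<Lambda> v = {\<alpha> \<in> mor \<Lambda>. rng \<Lambda> \<alpha> = v}"

definition paths_from :: "('a, 'k::finite) kgraph_data \<Rightarrow> 'a \<Rightarrow> nat ^ 'k \<Rightarrow> 'a set" where
  "paths_from \<Lambda> v n = mor_from \<Lambda> v \<inter> paths \<Lambda> n"

text \<open>The morphisms of degree 0 are exactly the identity morphisms.\<close>

lemma (in k_graph) vertices_eq_identities: "vertices \<Lambda> = {v \<in> mor \<Lambda>. rng \<Lambda> v = v}"
proof (intro equalityI subsetI)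
  fix v assume "v \<in> vertices \<Lambda>"
  then have v: "v \<in> mor \<Lambda>" "deg \<Lambda> v = 0" by (auto simp: vertices_def paths_def)
  define P where "P = (\<lambda>(\<mu>, \<nu>). \<mu> \<in> mor \<Lambda> \<and> \<nu> \<in> mor \<Lambda> \<and> src \<Lambda> \<mu> = rng \<Lambda> \<nu> \<and>
          deg \<Lambda> \<mu> = 0 \<and> deg \<Lambda> \<nu> = 0 \<and> v = pcomp \<Lambda> \<mu> \<nu>)"
  have ex: "\<exists>!p. P p" using factorisation[OF v(1), of 0 0] v(2) by (simp add: P_def)
  have "P (rng \<Lambda> v, v)" "P (v, src \<Lambda> v)"
    using v by (simp_all add: P_def rng_closed src_closed src_rng rng_src deg_rng deg_src
        rng_pcomp_id pcomp_src_id)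
  with ex have "(rng \<Lambda> v, v) = (v, src \<Lambda> v)" by blast
  then show "v \<in> {v \<in> mor \<Lambda>. rng \<Lambda> v = v}" using v by simp
next
  fix v assume "v \<in> {v \<in> mor \<Lambda>. rng \<Lambda> v = v}"
  then show "v \<in> vertices \<Lambda>" using deg_rng[of v] by (simp add: vertices_def paths_def)
qed

definition row_finite :: "('a, 'k::finite) kgraph_data \<Rightarrow> bool" where
  "row_finite \<Lambda> \<longleftrightarrow> (\<forall>v\<in>vertices \<Lambda>. \<forall>n. finite (paths_from \<Lambda> v n))"

definition no_sources :: "('a, 'k::finite) kgraph_data \<Rightarrow> bool" where
  "no_sources \<Lambda> \<longleftrightarrow> (\<forall>v\<in>vertices \<Lambda>. \<forall>n. paths_from \<Lambda> v n \<noteq> {})"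

definition cofinal_graph :: "('a, 'k::finite) kgraph_data \<Rightarrow> bool" where
  "cofinal_graph \<Lambda> \<longleftrightarrow> (\<forall>v\<in>vertices \<Lambda>. \<forall>w\<in>vertices \<Lambda>. \<exists>n.
     src \<Lambda> ` paths_from \<Lambda> w n \<subseteq> src \<Lambda> ` mor_from \<Lambda> v)"

definition is_cycle :: "('a, 'k::finite) kgraph_data \<Rightarrow> 'a \<Rightarrow> bool" where
  "is_cycle \<Lambda> \<alpha> \<longleftrightarrow> \<alpha> \<in> mor \<Lambda> \<and> src \<Lambda> \<alpha> = rng \<Lambda> \<alpha>"

text \<open>
  Finitely supported functions from the vertices to \<open>nat\<close> are multisets of vertices;
  the generator at \<open>v\<close> is \<open>{#v#}\<close>.
\<close>

definition free_vertex_monoid :: "('a, 'k::finite) kgraph_data \<Rightarrow> 'a multiset set" where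
  "free_vertex_monoid \<Lambda> = {x. set_mset x \<subseteq> vertices \<Lambda>}"

text \<open>
  \<open>adj \<Lambda> n\<close> is the transposed adjacency matrix of degree \<open>n\<close> acting on multisets. The inner sum
  is over a finite set only when the graph is row-finite.
\<close>

definition adj :: "('a, 'k::finite) kgraph_data \<Rightarrow> nat ^ 'k \<Rightarrow> 'a multiset \<Rightarrow> 'a multiset" where
  "adj \<Lambda> n x = (\<Sum>v\<in>#x. \<Sum>\<alpha>\<in>paths_from \<Lambda> v n. {#src \<Lambda> \<alpha>#})"

definition gsim :: "('a, 'k::finite) kgraph_data \<Rightarrow> 'a multiset \<Rightarrow> 'a multiset \<Rightarrow> bool" where
  "gsim \<Lambda> x y \<longleftrightarrow> (\<exists>p q. adj \<Lambda> p x = adj \<Lambda> q y)"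

definition gapprox :: "('a, 'k::finite) kgraph_data \<Rightarrow> ('a multiset \<times> 'a multiset) set" where
  "gapprox \<Lambda> = {(f, g). f \<in> free_vertex_monoid \<Lambda> \<and> g \<in> free_vertex_monoid \<Lambda> \<and>
     (\<exists>(N::nat) x y.
        (\<forall>i<N. x i \<in> free_vertex_monoid \<Lambda> \<and> y i \<in> free_vertex_monoid \<Lambda>) \<and>
        gsim \<Lambda> f (\<Sum>i<N. x i) \<and> gsim \<Lambda> g (\<Sum>i<N. y i) \<and>
        (\<forall>i<N. gsim \<Lambda> (x i) (y i)))}"

text \<open>
  A preordered abelian semigroup with identity is a HOL-Algebra commutative monoid together with
  a preorder. HOL-Algebra writes monoids multiplicatively: \<open>\<otimes>\<close> is the addition, \<open>\<one>\<close> is the zero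
  element, and \<open>2x\<close> is \<open>x \<otimes> x\<close>.
\<close>

record 'b preordered_monoid = "'b monoid" +
  ple :: "'b \<Rightarrow> 'b \<Rightarrow> bool"

definition infinite_element :: "'b preordered_monoid \<Rightarrow> 'b \<Rightarrow> bool" where
  "infinite_element S x \<longleftrightarrow> x \<in> carrier S \<and> x \<noteq> \<one>\<^bsub>S\<^esub> \<and>
     (\<exists>y\<in>carrier S. y \<noteq> \<one>\<^bsub>S\<^esub> \<and> x \<otimes>\<^bsub>S\<^esub> y = x)"

definition properly_infinite_element :: "'b preordered_monoid \<Rightarrow> 'b \<Rightarrow> bool" where
  "properly_infinite_element S x \<longleftrightarrow> x \<in> carrier S \<and> x \<noteq> \<one>\<^bsub>S\<^esub> \<and> ple S (x \<otimes>\<^bsub>S\<^esub> x) x"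

definition stably_finite :: "'b preordered_monoid \<Rightarrow> bool" where
  "stably_finite S \<longleftrightarrow> \<not> (\<exists>x. infinite_element S x)"

definition purely_infinite :: "'b preordered_monoid \<Rightarrow> bool" where
  "purely_infinite S \<longleftrightarrow> (\<forall>x\<in>carrier S. x \<noteq> \<one>\<^bsub>S\<^esub> \<longrightarrow> properly_infinite_element S x)"

definition totally_ordered :: "'b preordered_monoid \<Rightarrow> bool" where
  "totally_ordered S \<longleftrightarrow>
     linear_order_on (carrier S) {(x, y). x \<in> carrier S \<and> y \<in> carrier S \<and> ple S x y}"

definition algebraic_le :: "('b, 'm) monoid_scheme \<Rightarrow> 'b \<Rightarrow> 'b \<Rightarrow> bool" where
  "algebraic_le M a b \<longleftrightarrow> (\<exists>c\<in>carrier M. a \<otimes>\<^bsub>M\<^esub> c = b)"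

text \<open>
  The sum of two classes is written as a union over representatives; since \<open>gapprox \<Lambda>\<close> is a
  congruence, all the classes in this union coincide.
\<close>

definition S_monoid :: "('a, 'k::finite) kgraph_data \<Rightarrow> 'a multiset set monoid" where
  "S_monoid \<Lambda> =
     \<lparr>carrier = free_vertex_monoid \<Lambda> // gapprox \<Lambda>,
      monoid.mult = (\<lambda>A B. \<Union>f\<in>A. \<Union>g\<in>B. gapprox \<Lambda> `` {f + g}),
      one = gapprox \<Lambda> `` {{#}}\<rparr>"

definition S_of :: "('a, 'k::finite) kgraph_data \<Rightarrow> 'a multiset set preordered_monoid" where
  "S_of \<Lambda> = monoid.extend (S_monoid \<Lambda>) \<lparr>ple = algebraic_le (S_monoid \<Lambda>)\<rparr>"

end

theory Submission
  imports Defs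
begin

text \<open>
  Let \<open>v\<close> be the base of the cycle and \<open>n\<close> its degree, so that \<open>A\<^sub>n \<delta>\<^sub>v = \<delta>\<^sub>v + y\<close> for some \<open>y\<close>.
  Since \<open>n \<ge> (1,\<dots>,1)\<close>, every degree is dominated by a multiple of \<open>n\<close>; together with cofinality
  this gives \<open>[v] \<le> [w]\<close> for all vertices \<open>w\<close>, and cofinality alone bounds each class by a multiple
  of \<open>[v]\<close>. If \<open>y \<noteq> 0\<close>, then \<open>2[v] \<le> [v] + [y] = [v]\<close>, so any two nonzero classes dominate each
  other. If \<open>y = 0\<close>, every vertex reachable from \<open>v\<close> is the range of exactly one path of
  each degree; the classes are then the multiples of \<open>[v]\<close>, and they are pairwise distinct because
  the maps \<open>A\<^sub>p\<close> preserve the size of multisets of such vertices.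
\<close>

section \<open>Decomposition and refinement of multiset sums, and a bound on degrees\<close>

lemma subset_mset_sum_split:
  fixes b :: "nat \<Rightarrow> 'b multiset"
  assumes "a \<subseteq># (\<Sum>j<M. b j)"
  shows "\<exists>c. (\<forall>j<M. c j \<subseteq># b j) \<and> a = (\<Sum>j<M. c j)"
  using assms
proof (induction M arbitrary: a)
  case 0
  then show ?case by simp
next
  case (Suc M)
  \<comment> \<open>Greedy splitting: the last block takes \<open>a \<inter># b M\<close>, as much
    of \<open>a\<close> as fits, and the remainder \<open>a - b M\<close> goes to the earlier blocks
    by induction.\<close>
  have "a - b M \<subseteq># (\<Sum>j<M. b j)"
    using Suc.prems by (simp add: subset_eq_diff_conv)
  then obtain c where c: "\<forall>j<M. c j \<subseteq># b j" "a - b M = (\<Sum>j<M. c j)"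
    using Suc.IH by blast
  have "(\<Sum>j<M. (c(M := a \<inter># b M)) j) = (\<Sum>j<M. c j)" by (intro sum.cong) auto
  then have "a = (\<Sum>j<Suc M. (c(M := a \<inter># b M)) j)"
    using c(2) by (simp add: multiset_eq_iff) (metis add.commute diff_add_inverse2 le_add_diff_inverse min_def nat_le_linear diff_is_0_eq add_0)
  moreover have "\<forall>j<Suc M. (c(M := a \<inter># b M)) j \<subseteq># b j"
    using c(1) by (auto simp: less_Suc_eq)
  ultimately show ?case by blast
qed

text \<open>Riesz refinement: the \<open>w i j\<close> form a matrix with row sums
  \<open>a i\<close> and column sums \<open>b j\<close>. The induction peels off the last row by the
  splitting lemma and subtracts it from the columns. Transitivity of \<open>\<approx>\<close> rests
  on this.\<close>

lemma multiset_sum_refinement: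
  fixes a b :: "nat \<Rightarrow> 'b multiset"
  assumes "(\<Sum>i<N. a i) = (\<Sum>j<M. b j)"
  shows "\<exists>w. (\<forall>i<N. a i = (\<Sum>j<M. w i j)) \<and> (\<forall>j<M. b j = (\<Sum>i<N. w i j))"
  using assms
proof (induction N arbitrary: b)
  case 0
  then show ?case by (metis less_nat_zero_code lessThan_0 finite_lessThan lessThan_iff sum.empty sum_eq_empty_iff)
next
  case (Suc N)
  have "a N \<subseteq># (\<Sum>j<M. b j)"
    by (metis Suc.prems sum.lessThan_Suc mset_subset_eq_add_right)
  then obtain c where c: "\<forall>j<M. c j \<subseteq># b j" "a N = (\<Sum>j<M. c j)"
    using subset_mset_sum_split by blast
  have "(\<Sum>j<M. b j) = (\<Sum>j<M. (b j - c j) + c j)"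
    using c(1) by (intro sum.cong) auto
  then have "(\<Sum>i<N. a i) = (\<Sum>j<M. b j - c j)"
    using Suc.prems c(2) by (simp add: sum.distrib)
  then obtain w where w: "\<forall>i<N. a i = (\<Sum>j<M. w i j)" "\<forall>j<M. b j - c j = (\<Sum>i<N. w i j)"
    using Suc.IH[of "\<lambda>j. b j - c j"] by blast
  let ?w = "w(N := c)"
  have "(\<Sum>i<N. ?w i j) = (\<Sum>i<N. w i j)" for j by (intro sum.cong) auto
  then have "\<forall>j<M. b j = (\<Sum>i<Suc N. ?w i j)"
    using w(2) c(1) by (metis fun_upd_same subset_mset.diff_add sum.lessThan_Suc)
  moreover have "\<forall>i<Suc N. a i = (\<Sum>j<M. ?w i j)"
    using w(1) c(2) by (auto simp: less_Suc_eq)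
  ultimately show ?case by blast
qed

lemma vec_nat_le_add_diff: "p \<le> q \<Longrightarrow> p + (q - p) = (q :: nat ^ 'k::finite)"
  by (simp add: vec_eq_iff less_eq_vec_def)

lemma vec_nat_le_multiple:
  fixes p n :: "nat ^ 'k::finite"
  assumes "1 \<le> n"
  shows "\<exists>m::nat. p \<le> (\<chi> i. m * n $ i)"
proof -
  \<comment> \<open>The multiplier is the sum of all coordinates of \<open>p\<close>: it bounds each
    \<open>p $ i\<close>, and each \<open>n $ i\<close> is at least 1.\<close>
  have "p $ i \<le> (\<Sum>j\<in>UNIV. p $ j) * n $ i" for i
  proof -
    have "p $ i * 1 \<le> (\<Sum>j\<in>UNIV. p $ j) * n $ i"
      using assms by (intro mult_mono member_le_sum) (auto simp: less_eq_vec_def)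
    then show ?thesis by simp
  qed
  then show ?thesis by (auto simp: less_eq_vec_def)
qed

section \<open>The adjacency maps of a row-finite graph without sources\<close>

locale row_finite_k_graph = k_graph \<Lambda> for \<Lambda> :: "('a, 'k::finite) kgraph_data" +
  assumes row_finite: "row_finite \<Lambda>" and no_sources: "no_sources \<Lambda>"
begin

abbreviation "FV \<equiv> free_vertex_monoid \<Lambda>"

abbreviation A :: "nat ^ 'k \<Rightarrow> 'a multiset \<Rightarrow> 'a multiset" where
  "A \<equiv> adj \<Lambda>"

abbreviation gapprox_rel (infix \<open>\<approx>\<close> 50) where "f \<approx> g \<equiv> (f, g) \<in> gapprox \<Lambda>"

lemma empty_in_FV [simp]: "{#} \<in> FV"
  and add_in_FV_iff [simp]: "x + y \<in> FV \<longleftrightarrow> x \<in> FV \<and> y \<in> FV"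
  and add_mset_in_FV_iff [simp]: "add_mset v x \<in> FV \<longleftrightarrow> v \<in> vertices \<Lambda> \<and> x \<in> FV"
  by (auto simp: free_vertex_monoid_def)

lemma sum_in_FV_iff: "finite I \<Longrightarrow> (\<Sum>i\<in>I. x i) \<in> FV \<longleftrightarrow> (\<forall>i\<in>I. x i \<in> FV)"
  by (induction I rule: finite_induct) auto

lemma finite_paths_from [simp]: "v \<in> vertices \<Lambda> \<Longrightarrow> finite (paths_from \<Lambda> v n)"
  using row_finite by (simp add: row_finite_def)

lemma src_in_vertices: "\<alpha> \<in> mor \<Lambda> \<Longrightarrow> src \<Lambda> \<alpha> \<in> vertices \<Lambda>"
  by (simp add: vertices_def paths_def src_closed deg_src)

lemma adj_empty [simp]: "A n {#} = {#}"
  and adj_add [simp]: "A n (x + y) = A n x + A n y"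
  by (simp_all add: adj_def)

lemma adj_single: "A n {#v#} = (\<Sum>\<alpha>\<in>paths_from \<Lambda> v n. {#src \<Lambda> \<alpha>#})"
  by (simp add: adj_def)

lemma adj_add_mset: "A n (add_mset v x) = A n {#v#} + A n x"
  by (metis add_mset_add_single adj_add add.commute)

lemma adj_sum: "A n (\<Sum>i\<in>I. x i) = (\<Sum>i\<in>I. A n (x i))"
  by (induction I rule: infinite_finite_induct) auto

lemma adj_mono: "x \<subseteq># y \<Longrightarrow> A n x \<subseteq># A n y"
  by (metis adj_add mset_subset_eq_exists_conv mset_subset_eq_add_left)

lemma set_adj_single:
  "v \<in> vertices \<Lambda> \<Longrightarrow> set_mset (A n {#v#}) = src \<Lambda> ` paths_from \<Lambda> v n"
  by (auto simp: adj_single set_mset_sum)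

lemma set_adj: "set_mset (A n x) = (\<Union>v\<in>set_mset x. set_mset (A n {#v#}))"
proof (induction x)
  case (add v x)
  then show ?case by (simp add: adj_add_mset[of n v x])
qed simp

lemma adj_in_FV [simp]:
  assumes "x \<in> FV"
  shows "A n x \<in> FV"
proof -
  have "set_mset (A n {#v#}) \<subseteq> vertices \<Lambda>" if "v \<in># x" for v
  proof -
    have "v \<in> vertices \<Lambda>" using that assms by (auto simp: free_vertex_monoid_def)
    then show ?thesis
      by (auto simp: set_adj_single paths_from_def paths_def src_in_vertices)
  qed
  then show ?thesis
    unfolding free_vertex_monoid_def using set_adj[of n x] by blast
qed

lemma paths_from_zero: "v \<in> vertices \<Lambda> \<Longrightarrow> paths_from \<Lambda> v 0 = {v}"
  using vertices_eq_identities
  by (auto simp: paths_from_def mor_from_def vertices_def)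

lemma src_vertex: "v \<in> vertices \<Lambda> \<Longrightarrow> src \<Lambda> v = v"
  using vertices_eq_identities src_rng[of v] by simp

lemma adj_zero [simp]: "x \<in> FV \<Longrightarrow> A 0 x = x"
proof (induction x)
  case (add v x)
  then show ?case
    by (simp add: adj_add_mset[of 0 v x] adj_single paths_from_zero src_vertex)
qed simp

text \<open>This is unique factorisation restricted to paths with range \<open>v\<close>: existence
  gives surjectivity, uniqueness gives injectivity. It is the counting behind the composition law of
  the maps \<open>A n\<close>.\<close>

lemma bij_betw_pcomp:
  assumes "v \<in> vertices \<Lambda>"
  shows "bij_betw (\<lambda>(\<mu>, \<nu>). pcomp \<Lambda> \<mu> \<nu>)
    (SIGMA \<mu>:paths_from \<Lambda> v n. paths_from \<Lambda> (src \<Lambda> \<mu>) m) (paths_from \<Lambda> v (n + m))"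
    (is "bij_betw ?f ?A ?B")
  unfolding bij_betw_def
proof
  define Q where "Q \<alpha> p \<longleftrightarrow> (case p of (\<mu>, \<nu>) \<Rightarrow> \<mu> \<in> mor \<Lambda> \<and> \<nu> \<in> mor \<Lambda> \<and>
      src \<Lambda> \<mu> = rng \<Lambda> \<nu> \<and> deg \<Lambda> \<mu> = n \<and> deg \<Lambda> \<nu> = m \<and> \<alpha> = pcomp \<Lambda> \<mu> \<nu>)" for \<alpha> p
  have ex1: "\<exists>!p. Q \<alpha> p" if "\<alpha> \<in> ?B" for \<alpha>
    using that factorisation[of \<alpha> n m]
    unfolding Q_def by (simp add: paths_from_def mor_from_def paths_def)
  have Q: "Q (?f p) p" if "p \<in> ?A" for p
    using that by (auto simp: Q_def paths_from_def mor_from_def paths_def)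
  have into: "?f p \<in> ?B" if "p \<in> ?A" for p
    using that by (auto simp: paths_from_def mor_from_def paths_def pcomp_closed rng_pcomp deg_pcomp)
  show "inj_on ?f ?A"
  proof (rule inj_onI)
    fix p q assume pq: "p \<in> ?A" "q \<in> ?A" "?f p = ?f q"
    have "Q (?f p) p" "Q (?f p) q" using Q[OF pq(1)] Q[OF pq(2)] pq(3) by simp_all
    then show "p = q" using ex1[OF into[OF pq(1)]] by (blast elim: ex1E)
  qed
  show "?f ` ?A = ?B"
  proof
    show "?f ` ?A \<subseteq> ?B" using into by blast
    show "?B \<subseteq> ?f ` ?A"
    proof
      fix \<alpha> assume \<alpha>: "\<alpha> \<in> ?B"
      obtain p where p: "Q \<alpha> p" using ex1[OF \<alpha>] by (rule ex1E)
      then have "p \<in> ?A" "\<alpha> = ?f p"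
        using \<alpha> by (auto simp: Q_def paths_from_def mor_from_def paths_def rng_pcomp)
      then show "\<alpha> \<in> ?f ` ?A" by (intro image_eqI)
    qed
  qed
qed

lemma adj_adj_single:
  assumes v: "v \<in> vertices \<Lambda>"
  shows "A m (A n {#v#}) = A (n + m) {#v#}"
proof -
  have fin: "\<forall>\<mu>\<in>paths_from \<Lambda> v n. finite (paths_from \<Lambda> (src \<Lambda> \<mu>) m)"
    by (auto simp: paths_from_def paths_def intro!: finite_paths_from[unfolded paths_from_def paths_def] src_in_vertices)
  have "A m (A n {#v#}) =
      (\<Sum>\<mu>\<in>paths_from \<Lambda> v n. \<Sum>\<nu>\<in>paths_from \<Lambda> (src \<Lambda> \<mu>) m. {#src \<Lambda> \<nu>#})"
    by (simp add: adj_single[of n] adj_sum) (simp add: adj_single)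
  also have "\<dots> = (\<Sum>(\<mu>, \<nu>)\<in>(SIGMA \<mu>:paths_from \<Lambda> v n. paths_from \<Lambda> (src \<Lambda> \<mu>) m). {#src \<Lambda> \<nu>#})"
    using fin v by (simp add: sum.Sigma)
  also have "\<dots> = (\<Sum>p\<in>(SIGMA \<mu>:paths_from \<Lambda> v n. paths_from \<Lambda> (src \<Lambda> \<mu>) m).
      {#src \<Lambda> ((\<lambda>(\<mu>, \<nu>). pcomp \<Lambda> \<mu> \<nu>) p)#})"
    \<comment> \<open>A composite has the source of its second factor, so the summand depends only
      on the composite path and the sum can be reindexed.\<close>
    by (intro sum.cong refl)
      (auto simp: paths_from_def mor_from_def paths_def src_pcomp)
  also have "\<dots> = A (n + m) {#v#}"
    unfolding adj_single by (rule sum.reindex_bij_betw[OF bij_betw_pcomp[OF v]])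
  finally show ?thesis .
qed

lemma adj_adj: "x \<in> FV \<Longrightarrow> A m (A n x) = A (n + m) x"
proof (induction x)
  case (add v x)
  then show ?case
    by (simp add: adj_add_mset[of n v x] adj_add_mset[of "n + m" v x] adj_adj_single)
qed simp

lemma size_adj_single: "v \<in> vertices \<Lambda> \<Longrightarrow> 1 \<le> size (A n {#v#})"
proof -
  assume v: "v \<in> vertices \<Lambda>"
  then have "set_mset (A n {#v#}) \<noteq> {}"
    using no_sources by (simp add: set_adj_single no_sources_def)
  then show ?thesis by (simp add: Suc_le_eq nonempty_has_size)
qed

lemma size_adj_ge: "x \<in> FV \<Longrightarrow> size x \<le> size (A n x)"
proof (induction x)
  case (add v x)
  then show ?case using size_adj_single[of v n] by (simp add: adj_add_mset[of n v x])
qed simp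

lemma adj_diff_eq:
  "x \<in> FV \<Longrightarrow> p \<le> q \<Longrightarrow> A (q - p) (A p x) = A q x"
  by (simp add: adj_adj vec_nat_le_add_diff)

section \<open>The relation \<open>\<approx>\<close> is a congruence\<close>

lemma gsim_adj: "x \<in> FV \<Longrightarrow> gsim \<Lambda> (A m x) (A n x)"
  unfolding gsim_def by (metis adj_adj add.commute)

text \<open>A flexible introduction rule: the index set may be any finite set, which permits pairs
  in the transitivity proof and an extra index in the additivity proof. A bijection with
  \<open>{..<card I}\<close> brings it back to the definition.\<close>

lemma gapproxI:
  fixes I :: "'i set"
  assumes I: "finite I" and fg: "f \<in> FV" "g \<in> FV"
    and eq: "A p f = (\<Sum>i\<in>I. x i)" "A q g = (\<Sum>i\<in>I. y i)"
    and sim: "\<And>i. i \<in> I \<Longrightarrow> gsim \<Lambda> (x i) (y i)"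
  shows "f \<approx> g"
proof -
  obtain h where h: "bij_betw h {..<card I} I"
    using ex_bij_betw_nat_finite[OF I] by (auto simp: atLeast0LessThan)
  \<comment> \<open>The summands lie in \<open>FV\<close> because their sum is the image of an
    element of \<open>FV\<close>.\<close>
  have xy: "x i \<in> FV \<and> y i \<in> FV" if "i \<in> I" for i
    using that fg eq sum_in_FV_iff[OF I, of x] sum_in_FV_iff[OF I, of y] by (metis adj_in_FV)
  have s: "(\<Sum>i<card I. z (h i)) = (\<Sum>i\<in>I. z i)" for z :: "'i \<Rightarrow> 'a multiset"
    by (rule sum.reindex_bij_betw[OF h])
  have hI: "h i \<in> I" if "i < card I" for i using h that by (auto simp: bij_betw_def)
  have "gsim \<Lambda> f (\<Sum>i<card I. x (h i))" "gsim \<Lambda> g (\<Sum>i<card I. y (h i))"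
    unfolding s eq[symmetric] gsim_def using fg by (metis adj_in_FV adj_zero)+
  moreover have "\<forall>i<card I. x (h i) \<in> FV \<and> y (h i) \<in> FV" "\<forall>i<card I. gsim \<Lambda> (x (h i)) (y (h i))"
    using xy sim hI by auto
  ultimately show ?thesis
    unfolding gapprox_def mem_Collect_eq prod.case
    using fg by (intro conjI exI[of _ "card I"] exI[of _ "\<lambda>i. x (h i)"] exI[of _ "\<lambda>i. y (h i)"])
qed

text \<open>
  After shifting the degrees, the relation \<open>x\<^sub>i \<sim> y\<^sub>i\<close> becomes one-sided: \<open>x\<^sub>i\<close> is the image of \<open>y\<^sub>i\<close>
  under some \<open>A\<^sub>c\<close>, with \<open>c\<close> depending on \<open>i\<close>. This makes the refinement argument for transitivity work.
\<close>

lemma gapproxE: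
  assumes "f \<approx> g"
  obtains p q y c and N :: nat where "f \<in> FV" "g \<in> FV" "\<And>i. i < N \<Longrightarrow> y i \<in> FV"
    "A p f = (\<Sum>i<N. A (c i) (y i))" "A q g = (\<Sum>i<N. y i)"
proof -
  obtain N :: nat and x y where fg: "f \<in> FV" "g \<in> FV"
    and xy: "\<And>i. i < N \<Longrightarrow> x i \<in> FV \<and> y i \<in> FV"
    and sim: "gsim \<Lambda> f (\<Sum>i<N. x i)" "gsim \<Lambda> g (\<Sum>i<N. y i)"
      "\<And>i. i < N \<Longrightarrow> gsim \<Lambda> (x i) (y i)"
    using assms unfolding gapprox_def by blast
  obtain p q p' q' where pq: "A p f = A q (\<Sum>i<N. x i)" "A p' g = A q' (\<Sum>i<N. y i)"
    using sim(1,2) unfolding gsim_def by blast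
  obtain a b where ab: "\<And>i. i < N \<Longrightarrow> A (a i) (x i) = A (b i) (y i)"
    using sim(3) unfolding gsim_def by metis
  \<comment> \<open>\<open>P\<close> is a common upper bound of the degrees \<open>a i\<close>. The
    shift \<open>c i\<close> first raises \<open>a i\<close> to \<open>P\<close> and then adds
    \<open>q\<close>, so that a single degree \<open>P + q\<close> works for all
    \<open>x i\<close>.\<close>
  define P where "P = (\<Sum>i<N. a i)"
  define c where "c i = b i + (P - a i) + q" for i
  have aP: "a i \<le> P" if "i < N" for i
    unfolding P_def less_eq_vec_def sum_component
    using that by (auto intro!: member_le_sum)
  have "A (P + q) (x i) = A (c i) (y i)" if i: "i < N" for i
  proof -
    have "A (P + q) (x i) = A (a i + (P - a i) + q) (x i)"
      using aP[OF i] by (simp add: vec_nat_le_add_diff)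
    also have "\<dots> = A q (A (P - a i) (A (a i) (x i)))"
      using xy[OF i] by (simp add: adj_adj add.assoc)
    also have "\<dots> = A (c i) (y i)"
      using xy[OF i] ab[OF i] by (simp add: adj_adj c_def add.assoc)
    finally show ?thesis .
  qed
  note PqC = this
  have xF: "(\<Sum>i<N. x i) \<in> FV" "(\<Sum>i<N. y i) \<in> FV" using xy by (auto simp: sum_in_FV_iff)
  \<comment> \<open>The part \<open>P\<close> of the extra shift aligns every \<open>x i\<close>
    with \<open>y i\<close>; the part \<open>q'\<close> replaces \<open>y i\<close> by
    \<open>A q' (y i)\<close>, the summand that occurs in \<open>A p' g\<close>.\<close>
  have "A (p + (P + q')) f = A (P + q') (A q (\<Sum>i<N. x i))"
    using fg pq by (simp add: adj_adj flip: pq)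
  also have "\<dots> = A q' (A (P + q) (\<Sum>i<N. x i))"
    using xF by (simp add: adj_adj ac_simps)
  also have "\<dots> = (\<Sum>i<N. A q' (A (c i) (y i)))"
    using PqC by (simp add: adj_sum)
  also have "\<dots> = (\<Sum>i<N. A (c i) (A q' (y i)))"
    using xy by (simp add: adj_adj add.commute)
  finally have "A (p + (P + q')) f = (\<Sum>i<N. A (c i) (A q' (y i)))" .
  moreover have "A p' g = (\<Sum>i<N. A q' (y i))" using pq by (simp add: adj_sum)
  ultimately show thesis using that[of N "\<lambda>i. A q' (y i)"] fg xy by auto
qed

lemma gsim_sym: "gsim \<Lambda> x y \<Longrightarrow> gsim \<Lambda> y x"
  unfolding gsim_def by metis

lemma gapprox_sym: "f \<approx> g \<Longrightarrow> g \<approx> f"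
  unfolding gapprox_def by (auto intro: gsim_sym) (metis gsim_sym)

lemma gapprox_in_FV: "f \<approx> g \<Longrightarrow> f \<in> FV \<and> g \<in> FV"
  by (auto simp: gapprox_def)

lemma gapprox_adj:
  assumes "f \<in> FV"
  shows "A n f \<approx> f"
proof (rule gapproxI[of "{()}" _ _ 0 "\<lambda>_. A n f" 0 "\<lambda>_. f"])
  show "gsim \<Lambda> (A n f) f" using gsim_adj[of f n 0] assms by simp
qed (use assms in auto)

lemma gapprox_refl: "f \<in> FV \<Longrightarrow> f \<approx> f"
  using gapprox_adj[of f 0] by simp

text \<open>Shifted copies of \<open>g\<close> carry one decomposition for \<open>f\<close> and one
  for \<open>h\<close>. Moving both to degree \<open>q + s\<close> makes their sums equal, and a
  common refinement \<open>w\<close> exists. Then \<open>f\<close> and \<open>h\<close> become sums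
  of \<open>A (c i) (w i j)\<close> and \<open>A (d j) (w i j)\<close>, which are images of the same
  multiset and hence related.\<close>

lemma gapprox_trans:
  assumes "f \<approx> g" "g \<approx> h"
  shows "f \<approx> h"
proof -
  obtain p q y c and N :: nat where f: "f \<in> FV" "g \<in> FV" "\<And>i. i < N \<Longrightarrow> y i \<in> FV"
    "A p f = (\<Sum>i<N. A (c i) (y i))" "A q g = (\<Sum>i<N. y i)"
    using assms(1) by (rule gapproxE) blast
  obtain r s z d and M :: nat where h: "h \<in> FV" "\<And>j. j < M \<Longrightarrow> z j \<in> FV"
    "A r h = (\<Sum>j<M. A (d j) (z j))" "A s g = (\<Sum>j<M. z j)"
    \<comment> \<open>Symmetry puts \<open>g\<close> on the unshifted side of this decomposition as
      well.\<close>
    using gapprox_sym[OF assms(2)] by (rule gapproxE) blast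
  have "(\<Sum>i<N. A s (y i)) = A s (A q g)" by (simp add: f(5) adj_sum)
  also have "\<dots> = A q (A s g)" using f(2) by (simp add: adj_adj add.commute)
  also have "\<dots> = (\<Sum>j<M. A q (z j))" by (simp add: h(4) adj_sum)
  finally obtain w where w: "\<forall>i<N. A s (y i) = (\<Sum>j<M. w i j)" "\<forall>j<M. A q (z j) = (\<Sum>i<N. w i j)"
    using multiset_sum_refinement by blast
  have wF: "w i j \<in> FV" if "i < N" "j < M" for i j
    using w(1) that f(3) sum_in_FV_iff[of "{..<M}" "w i"] by (metis adj_in_FV finite_lessThan lessThan_iff)
  have "A (p + s) f = A s (A p f)" using f(1) by (simp add: adj_adj)
  also have "\<dots> = (\<Sum>i<N. A (c i) (A s (y i)))" unfolding f(4) using f(3) by (simp add: adj_sum adj_adj add.commute)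
  also have "\<dots> = (\<Sum>i<N. \<Sum>j<M. A (c i) (w i j))" using w(1) by (simp add: adj_sum)
  also have "\<dots> = (\<Sum>(i, j)\<in>{..<N} \<times> {..<M}. A (c i) (w i j))" by (simp add: sum.cartesian_product)
  finally have 1: "A (p + s) f = (\<Sum>u\<in>{..<N} \<times> {..<M}. case u of (i, j) \<Rightarrow> A (c i) (w i j))" .
  have "A (r + q) h = A q (A r h)" using h(1) by (simp add: adj_adj)
  also have "\<dots> = (\<Sum>j<M. A (d j) (A q (z j)))" unfolding h(3) using h(2) by (simp add: adj_sum adj_adj add.commute)
  also have "\<dots> = (\<Sum>j<M. \<Sum>i<N. A (d j) (w i j))" using w(2) by (simp add: adj_sum)
  also have "\<dots> = (\<Sum>i<N. \<Sum>j<M. A (d j) (w i j))" by (rule sum.swap)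
  also have "\<dots> = (\<Sum>(i, j)\<in>{..<N} \<times> {..<M}. A (d j) (w i j))" by (simp add: sum.cartesian_product)
  finally have 2: "A (r + q) h = (\<Sum>u\<in>{..<N} \<times> {..<M}. case u of (i, j) \<Rightarrow> A (d j) (w i j))" .
  show ?thesis
    by (rule gapproxI[OF _ f(1) h(1) 1 2]) (auto intro: gsim_adj wF)
qed

lemma gapprox_add_right:
  assumes "f \<approx> g" "h \<in> FV"
  shows "f + h \<approx> g + h"
proof -
  obtain p q y c and N :: nat where f: "f \<in> FV" "g \<in> FV" "\<And>i. i < N \<Longrightarrow> y i \<in> FV"
    "A p f = (\<Sum>i<N. A (c i) (y i))" "A q g = (\<Sum>i<N. y i)"
    using assms(1) by (rule gapproxE) blast
  show ?thesis
  \<comment> \<open>The additional index \<open>N\<close> carries the pair \<open>A p h\<close>,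
    \<open>A q h\<close>.\<close>
  proof (rule gapproxI[of "{..<Suc N}"])
    show "A p (f + h) = (\<Sum>i<Suc N. if i < N then A (c i) (y i) else A p h)"
      by (simp add: f(4))
    show "A q (g + h) = (\<Sum>i<Suc N. if i < N then y i else A q h)"
      by (simp add: f(5))
    show "gsim \<Lambda> (if i < N then A (c i) (y i) else A p h) (if i < N then y i else A q h)" for i
      using gsim_adj[of h p q] gsim_adj[of "y i" "c i" 0] f(3)[of i] assms(2) by auto
  qed (use f assms(2) in auto)
qed

lemma gapprox_add:
  assumes "f \<approx> f'" "g \<approx> g'"
  shows "f + g \<approx> f' + g'"
  using gapprox_trans[OF gapprox_add_right[of f f' g] gapprox_add_right[of g g' f', unfolded add.commute[of _ f']]]
    assms gapprox_in_FV by blast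

lemma equiv_gapprox: "equiv FV (gapprox \<Lambda>)"
  by (rule equivI)
    (auto simp: refl_on_def sym_def trans_def gapprox_refl intro: gapprox_sym gapprox_trans
      dest: gapprox_in_FV)

section \<open>The semigroup and its preorder on representatives\<close>

definition cls :: "'a multiset \<Rightarrow> 'a multiset set" where
  "cls f = gapprox \<Lambda> `` {f}"

lemma cls_eq_iff: "f \<in> FV \<Longrightarrow> g \<in> FV \<Longrightarrow> cls f = cls g \<longleftrightarrow> f \<approx> g"
  unfolding cls_def using eq_equiv_class_iff[OF equiv_gapprox] by blast

lemma carrier_S: "carrier (S_of \<Lambda>) = cls ` FV"
  by (auto simp: S_of_def S_monoid_def monoid.defs quotient_def cls_def)

lemma one_S: "\<one>\<^bsub>S_of \<Lambda>\<^esub> = cls {#}"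
  by (simp add: S_of_def S_monoid_def monoid.defs cls_def)

lemma mult_S_monoid:
  assumes "f \<in> FV" "g \<in> FV"
  shows "cls f \<otimes>\<^bsub>S_monoid \<Lambda>\<^esub> cls g = cls (f + g)"
proof -
  have "gapprox \<Lambda> `` {f' + g'} = cls (f + g)" if "f' \<in> cls f" "g' \<in> cls g" for f' g'
    using that gapprox_add[of f f' g g'] gapprox_in_FV cls_eq_iff[of "f + g" "f' + g'"] assms
    unfolding cls_def by auto
  \<comment> \<open>Both classes are nonempty, so the union of equal classes is that class rather
    than the empty set.\<close>
  moreover have "f \<in> cls f" "g \<in> cls g" using assms by (auto simp: cls_def gapprox_refl)
  ultimately show ?thesis by (auto simp: S_monoid_def)
qed

lemma mult_S: "f \<in> FV \<Longrightarrow> g \<in> FV \<Longrightarrow> cls f \<otimes>\<^bsub>S_of \<Lambda>\<^esub> cls g = cls (f + g)"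
  using mult_S_monoid by (simp add: S_of_def monoid.defs)

text \<open>The algebraic preorder of the semigroup read on representatives, so that inequalities
  can be proved with multisets.\<close>

definition dominated (infix \<open>\<preceq>\<close> 50) where
  "f \<preceq> g \<longleftrightarrow> (\<exists>h\<in>FV. f + h \<approx> g)"

lemma ple_S: "f \<in> FV \<Longrightarrow> g \<in> FV \<Longrightarrow> ple (S_of \<Lambda>) (cls f) (cls g) \<longleftrightarrow> f \<preceq> g"
  by (auto simp: S_of_def monoid.defs algebraic_le_def dominated_def mult_S_monoid cls_eq_iff
      carrier_S[unfolded S_of_def monoid.defs, simplified])

lemma gapprox_dominated: "f \<approx> g \<Longrightarrow> f \<preceq> g"
  unfolding dominated_def by (metis add.right_neutral empty_in_FV)

lemma dominated_trans:
  assumes "f \<preceq> g" "g \<preceq> h"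
  shows "f \<preceq> h"
proof -
  obtain a b where a: "a \<in> FV" "f + a \<approx> g" and b: "b \<in> FV" "g + b \<approx> h"
    using assms by (auto simp: dominated_def)
  have "f + (a + b) \<approx> h"
    using gapprox_trans[OF gapprox_add_right[OF a(2) b(1)] b(2)] by (simp add: add.assoc)
  then show ?thesis using a b unfolding dominated_def by (metis add_in_FV_iff)
qed

lemma dominated_add:
  assumes "f \<preceq> g" "f' \<preceq> g'"
  shows "f + f' \<preceq> g + g'"
proof -
  obtain a b where a: "a \<in> FV" "f + a \<approx> g" and b: "b \<in> FV" "f' + b \<approx> g'"
    using assms by (auto simp: dominated_def)
  have "(f + f') + (a + b) \<approx> g + g'"
    using gapprox_add[OF a(2) b(2)] by (simp add: ac_simps)
  then show ?thesis using a b unfolding dominated_def by (metis add_in_FV_iff)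
qed

lemma subset_dominated: "g \<in> FV \<Longrightarrow> f \<subseteq># g \<Longrightarrow> f \<preceq> g"
  unfolding dominated_def
  by (metis gapprox_refl subset_mset.add_diff_inverse add_in_FV_iff)

text \<open>\<open>u\<close> is a summand of \<open>A n f\<close>, which has the same class as
  \<open>f\<close>. Thus reachability between vertices yields inequalities between classes.\<close>

lemma mem_adj_dominated:
  "f \<in> FV \<Longrightarrow> u \<in># A n f \<Longrightarrow> {#u#} \<preceq> f"
  by (rule dominated_trans[OF subset_dominated gapprox_dominated[OF gapprox_adj[of f n]]]) simp_all

end

section \<open>Reachability and domination in a cofinal graph with a cycle\<close>

locale cofinal_cyclic_k_graph = row_finite_k_graph \<Lambda> for \<Lambda> :: "('a, 'k::finite) kgraph_data" +
  fixes \<gamma> :: 'a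
  assumes cofinal: "cofinal_graph \<Lambda>" and cycle: "is_cycle \<Lambda> \<gamma>" and deg_cycle: "1 \<le> deg \<Lambda> \<gamma>"
begin

definition base :: 'a where "base = rng \<Lambda> \<gamma>"

text \<open>These are the vertices reachable from \<open>v\<close>, that is, the sources of all
  paths with range \<open>v\<close>.\<close>

definition descendants :: "'a \<Rightarrow> 'a set" where
  "descendants v = (\<Union>p. set_mset (A p {#v#}))"

text \<open>The degree of the \<open>m\<close>-fold power of the cycle.\<close>

definition deg_mult :: "nat \<Rightarrow> nat ^ 'k" where
  "deg_mult m = (\<chi> i. m * deg \<Lambda> \<gamma> $ i)"

lemma deg_mult_Suc: "deg_mult (Suc m) = deg_mult m + deg \<Lambda> \<gamma>"
  and deg_mult_0: "deg_mult 0 = 0"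
  by (simp_all add: deg_mult_def vec_eq_iff)

lemma le_deg_mult: "\<exists>m. p \<le> deg_mult m"
  unfolding deg_mult_def by (rule vec_nat_le_multiple[OF deg_cycle])

lemma base_vertex [simp]: "base \<in> vertices \<Lambda>"
  using cycle src_in_vertices[of \<gamma>] by (simp add: base_def is_cycle_def)

lemma base_in_adj_cycle: "base \<in># A (deg \<Lambda> \<gamma>) {#base#}"
proof -
  have "\<gamma> \<in> paths_from \<Lambda> base (deg \<Lambda> \<gamma>)" "base = src \<Lambda> \<gamma>"
    using cycle by (simp_all add: base_def is_cycle_def paths_from_def mor_from_def paths_def)
  then show ?thesis unfolding set_adj_single[OF base_vertex] by (intro image_eqI)
qed

lemma base_in_adj_mult: "base \<in># A (deg_mult m) {#base#}"
proof (induction m)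
  case 0
  then show ?case by (simp add: deg_mult_0)
next
  case (Suc m)
  then have "set_mset (A (deg \<Lambda> \<gamma>) {#base#}) \<subseteq> set_mset (A (deg \<Lambda> \<gamma>) (A (deg_mult m) {#base#}))"
    by (intro set_mset_mono adj_mono) simp
  then show ?case using base_in_adj_cycle by (auto simp: adj_adj deg_mult_Suc)
qed

lemma src_mor_from: "v \<in> vertices \<Lambda> \<Longrightarrow> src \<Lambda> ` mor_from \<Lambda> v = descendants v"
  by (auto simp: descendants_def set_adj_single paths_from_def paths_def mor_from_def)

lemma ex_adj_subset_descendants:
  "v \<in> vertices \<Lambda> \<Longrightarrow> w \<in> vertices \<Lambda> \<Longrightarrow> \<exists>n. set_mset (A n {#w#}) \<subseteq> descendants v"
  using cofinal by (simp add: cofinal_graph_def set_adj_single src_mor_from)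

lemma descendants_trans:
  assumes "v \<in> vertices \<Lambda>" "u \<in> descendants v"
  shows "set_mset (A p {#u#}) \<subseteq> descendants v"
proof -
  obtain q where "u \<in># A q {#v#}" using assms by (auto simp: descendants_def)
  then have "set_mset (A p {#u#}) \<subseteq> set_mset (A p (A q {#v#}))"
    by (intro set_mset_mono adj_mono) simp
  then show ?thesis using assms by (auto simp: adj_adj descendants_def)
qed

lemma adj_subset_descendants:
  "v \<in> vertices \<Lambda> \<Longrightarrow> set_mset x \<subseteq> descendants v \<Longrightarrow> set_mset (A p x) \<subseteq> descendants v"
  unfolding set_adj[of p x] using descendants_trans by blast

text \<open>Cofinality supplies a degree for each vertex separately. Since the set of descendants is
  stable under every \<open>A p\<close>, adding the degrees handles finitely many vertices at
  once.\<close>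

lemma ex_adj_subset_descendants_FV:
  assumes "x \<in> FV"
  shows "\<exists>n. set_mset (A n x) \<subseteq> descendants base"
  using assms
proof (induction x)
  case (add w x)
  then obtain n where n: "set_mset (A n x) \<subseteq> descendants base" by auto
  obtain m where m: "set_mset (A m {#w#}) \<subseteq> descendants base"
    using add.prems ex_adj_subset_descendants by force
  have "A (n + m) (add_mset w x) = A n (A m {#w#}) + A m (A n x)"
    using add.prems by (simp add: adj_add_mset[of _ w x] adj_adj add.commute)
  then have "set_mset (A (n + m) (add_mset w x)) \<subseteq> descendants base"
    using adj_subset_descendants[OF base_vertex m] adj_subset_descendants[OF base_vertex n] by simp
  then show ?case by blast
qed simp

lemma base_dominated:
  assumes w: "w \<in> vertices \<Lambda>"
  shows "{#base#} \<preceq> {#w#}"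
proof -
  obtain n where n: "set_mset (A n {#base#}) \<subseteq> descendants w"
    using ex_adj_subset_descendants[OF w base_vertex] by blast
  obtain m where m: "n \<le> deg_mult m" using le_deg_mult by blast
  \<comment> \<open>Running round the cycle \<open>m\<close> times returns to the base. That path
    has degree at least \<open>n\<close>, so it passes through the support of
    \<open>A n {#base#}\<close>, which is reachable from \<open>w\<close>; hence the base is
    reachable from \<open>w\<close> too.\<close>
  have "base \<in># A (deg_mult m - n) (A n {#base#})"
    using base_in_adj_mult m by (simp add: adj_diff_eq)
  then have "base \<in> descendants w"
    using adj_subset_descendants[OF w n] by blast
  then show ?thesis using w by (auto simp: descendants_def intro: mem_adj_dominated)
qed

lemma base_dominated_nonempty:
  assumes "f \<in> FV" "f \<noteq> {#}"
  shows "{#base#} \<preceq> f"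
proof -
  obtain w where w: "w \<in># f" using assms(2) by blast
  then have "w \<in> vertices \<Lambda>" using assms(1) by (auto simp: free_vertex_monoid_def)
  then show ?thesis
    using dominated_trans[OF base_dominated subset_dominated[OF assms(1)]] w by simp
qed

lemma replicate_base_in_FV [simp]: "replicate_mset n base \<in> FV"
  by (induction n) auto

lemma dominated_replicate:
  assumes "set_mset f \<subseteq> descendants base"
  shows "f \<preceq> replicate_mset (size f) base"
  using assms
proof (induction f)
  case empty
  show ?case by (simp add: gapprox_dominated gapprox_refl)
next
  case (add u f)
  then have "{#u#} \<preceq> {#base#}"
    by (auto simp: descendants_def intro: mem_adj_dominated)
  with add have "{#u#} + f \<preceq> {#base#} + replicate_mset (size f) base"
    by (intro dominated_add) auto
  then show ?case by simp
qed

lemma dominated_replicate_base: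
  assumes "f \<in> FV"
  shows "\<exists>n. f \<preceq> replicate_mset n base"
proof -
  obtain p where "set_mset (A p f) \<subseteq> descendants base"
    using ex_adj_subset_descendants_FV[OF assms] by blast
  then show ?thesis
    using dominated_trans[OF gapprox_dominated[OF gapprox_sym[OF gapprox_adj[OF assms]]]]
      dominated_replicate by blast
qed

section \<open>The purely infinite case\<close>

lemma dominated_base:
  assumes ne: "A (deg \<Lambda> \<gamma>) {#base#} \<noteq> {#base#}" and f: "f \<in> FV"
  shows "f \<preceq> {#base#}"
proof -
  define y where "y = A (deg \<Lambda> \<gamma>) {#base#} - {#base#}"
  have y: "A (deg \<Lambda> \<gamma>) {#base#} = {#base#} + y"
    using base_in_adj_cycle by (simp add: y_def)
  have "{#base#} + y \<in> FV" using adj_in_FV[of "{#base#}" "deg \<Lambda> \<gamma>"] by (simp add: y)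
  then have yF: "y \<in> FV" "y \<noteq> {#}" using ne y by auto
  \<comment> \<open>As \<open>y\<close> is nonempty, it dominates the base. The right-hand side has
    the class of the base, so two copies are absorbed by one, and by induction any number of
    copies.\<close>
  have "{#base#} + {#base#} \<preceq> {#base#} + y"
    by (intro dominated_add base_dominated_nonempty yF) (simp_all add: base_dominated)
  then have two: "{#base#} + {#base#} \<preceq> {#base#}"
    using dominated_trans gapprox_dominated[OF gapprox_adj[of "{#base#}" "deg \<Lambda> \<gamma>"]] y by simp
  have "replicate_mset n base \<preceq> {#base#}" for n
  proof (induction n)
    case 0
    show ?case by (simp add: subset_dominated)
  next
    case (Suc n)
    have "{#base#} + replicate_mset n base \<preceq> {#base#} + {#base#}"
      by (intro dominated_add Suc) (simp add: base_dominated)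
    then show ?case using dominated_trans[OF _ two] by simp
  qed
  then show ?thesis using dominated_replicate_base[OF f] dominated_trans by blast
qed

lemma purely_infinite_case:
  assumes ne: "A (deg \<Lambda> \<gamma>) {#base#} \<noteq> {#base#}"
  shows "purely_infinite (S_of \<Lambda>)"
    and "\<forall>x\<in>carrier (S_of \<Lambda>). \<forall>y\<in>carrier (S_of \<Lambda>).
        x \<noteq> \<one>\<^bsub>S_of \<Lambda>\<^esub> \<longrightarrow> y \<noteq> \<one>\<^bsub>S_of \<Lambda>\<^esub> \<longrightarrow> ple (S_of \<Lambda>) x y"
proof -
  \<comment> \<open>The base lies between \<open>f\<close> and \<open>g\<close>. Proper infiniteness
    is the instance with \<open>f + f\<close> below \<open>f\<close>.\<close>
  have le: "f \<preceq> g" if "f \<in> FV" "g \<in> FV" "g \<noteq> {#}" for f g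
    using dominated_base[OF ne] base_dominated_nonempty dominated_trans that by blast
  then show "\<forall>x\<in>carrier (S_of \<Lambda>). \<forall>y\<in>carrier (S_of \<Lambda>).
        x \<noteq> \<one>\<^bsub>S_of \<Lambda>\<^esub> \<longrightarrow> y \<noteq> \<one>\<^bsub>S_of \<Lambda>\<^esub> \<longrightarrow> ple (S_of \<Lambda>) x y"
    by (auto simp: carrier_S one_S ple_S)
  show "purely_infinite (S_of \<Lambda>)"
    unfolding purely_infinite_def
  proof (intro ballI impI)
    fix x assume "x \<in> carrier (S_of \<Lambda>)" "x \<noteq> \<one>\<^bsub>S_of \<Lambda>\<^esub>"
    moreover from this obtain f where "f \<in> FV" "x = cls f" "f \<noteq> {#}"
      by (auto simp: carrier_S one_S)
    ultimately show "properly_infinite_element (S_of \<Lambda>) x"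
      by (simp add: properly_infinite_element_def mult_S ple_S le)
  qed
qed

section \<open>The stably finite case: the semigroup is a copy of the natural numbers\<close>

context
  assumes unique: "A (deg \<Lambda> \<gamma>) {#base#} = {#base#}"
begin

lemma adj_deg_mult_base: "A (deg_mult m) {#base#} = {#base#}"
proof (induction m)
  case (Suc m)
  have "A (deg_mult (Suc m)) {#base#} = A (deg \<Lambda> \<gamma>) (A (deg_mult m) {#base#})"
    by (simp add: adj_adj deg_mult_Suc)
  then show ?case using Suc unique by simp
qed (simp add: deg_mult_0)

text \<open>Squeezing: without sources sizes never decrease along the maps \<open>A n\<close>, while
  continuing from degree \<open>p\<close> to a multiple of the cycle degree ends at the single
  vertex \<open>base\<close>.\<close>

lemma size_adj_base: "size (A p {#base#}) = 1"
proof -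
  obtain m where m: "p \<le> deg_mult m" using le_deg_mult by blast
  have "size (A p {#base#}) \<le> size (A (deg_mult m - p) (A p {#base#}))"
    by (rule size_adj_ge) simp
  also have "\<dots> = 1" using m by (simp add: adj_diff_eq adj_deg_mult_base)
  finally show ?thesis using size_adj_single[OF base_vertex, of p] by simp
qed

lemma adj_base_descendant:
  assumes "u \<in> descendants base"
  shows "\<exists>p. A p {#base#} = {#u#}"
proof -
  obtain p where p: "u \<in># A p {#base#}" using assms by (auto simp: descendants_def)
  obtain w where "A p {#base#} = {#w#}"
    using size_1_singleton_mset[OF size_adj_base] by blast
  with p show ?thesis by auto
qed

lemma size_adj_descendants:
  "set_mset x \<subseteq> descendants base \<Longrightarrow> size (A q x) = size x"
proof (induction x)
  case (add u x)
  obtain p where "A p {#base#} = {#u#}" using adj_base_descendant add.prems by auto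
  \<comment> \<open>Since \<open>{#u#}\<close> is itself an image of \<open>{#base#}\<close>, so is
    \<open>A q {#u#}\<close>, now in degree \<open>p + q\<close>.\<close>
  then have "size (A q {#u#}) = 1"
    using size_adj_base[of "p + q"] adj_adj[of "{#base#}" q p] by simp
  with add show ?case by (simp add: adj_add_mset[of q u x])
qed simp

lemma gapprox_replicate:
  "set_mset x \<subseteq> descendants base \<Longrightarrow> x \<approx> replicate_mset (size x) base"
proof (induction x)
  case (add u x)
  obtain p where "A p {#base#} = {#u#}" using adj_base_descendant add.prems by auto
  then have "{#u#} \<approx> {#base#}" using gapprox_adj[of "{#base#}" p] by simp
  then have "{#u#} + x \<approx> {#base#} + replicate_mset (size x) base"
    using add by (intro gapprox_add) auto
  then show ?case by simp
qed (simp add: gapprox_refl)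

lemma ex_gapprox_replicate:
  assumes "f \<in> FV"
  shows "\<exists>n. f \<approx> replicate_mset n base"
proof -
  obtain p where "set_mset (A p f) \<subseteq> descendants base"
    using ex_adj_subset_descendants_FV[OF assms] by blast
  then show ?thesis
    using gapprox_trans[OF gapprox_sym[OF gapprox_adj[OF assms]]] gapprox_replicate by blast
qed

text \<open>Size is an invariant of classes among descendants of the base. In the one-sided
  decomposition the \<open>y i\<close> are parts of \<open>A q g\<close>, hence consist of
  descendants, and the shifts \<open>A (c i)\<close> preserve their sizes.\<close>

lemma gapprox_size_eq:
  assumes "f \<approx> g" "set_mset f \<subseteq> descendants base" "set_mset g \<subseteq> descendants base"
  shows "size f = size g"
proof -
  obtain p q y c and N :: nat where fg: "A p f = (\<Sum>i<N. A (c i) (y i))" "A q g = (\<Sum>i<N. y i)"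
    using assms(1) by (rule gapproxE) blast
  have "set_mset (A q g) \<subseteq> descendants base"
    using adj_subset_descendants assms(3) by simp
  then have "set_mset (y i) \<subseteq> descendants base" if "i < N" for i
    using that unfolding fg(2) by (auto simp: set_mset_sum)
  then have sz: "size (A (c i) (y i)) = size (y i)" if "i < N" for i
    using that by (simp add: size_adj_descendants)
  have "size f = size (A p f)" using assms(2) by (simp add: size_adj_descendants)
  also have "\<dots> = size (A q g)" using sz by (simp add: fg size_multiset_sum)
  also have "\<dots> = size g" using assms(3) by (simp add: size_adj_descendants)
  finally show ?thesis .
qed

lemma base_descendant: "set_mset (replicate_mset n base) \<subseteq> descendants base"
  using base_in_adj_cycle by (auto simp: descendants_def)

definition mult_base :: "nat \<Rightarrow> 'a multiset set" where
  "mult_base n = cls (replicate_mset n base)"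

text \<open>Injectivity comes from the size invariant. With surjectivity and additivity below,
  \<open>mult_base\<close> identifies the semigroup with the natural numbers under addition.\<close>

lemma mult_base_eq_iff: "mult_base m = mult_base n \<longleftrightarrow> m = n"
  using gapprox_size_eq[OF _ base_descendant base_descendant, of m n]
  by (auto simp: mult_base_def cls_eq_iff gapprox_refl)

lemma carrier_S_mult_base: "carrier (S_of \<Lambda>) = range mult_base"
proof -
  have "cls f \<in> range mult_base" if "f \<in> FV" for f
    using ex_gapprox_replicate[OF that] that cls_eq_iff[of f]
    by (force simp: mult_base_def)
  then show ?thesis by (auto simp: carrier_S mult_base_def)
qed

lemma one_S_mult_base: "\<one>\<^bsub>S_of \<Lambda>\<^esub> = mult_base 0"
  by (simp add: one_S mult_base_def)

lemma mult_S_mult_base: "mult_base m \<otimes>\<^bsub>S_of \<Lambda>\<^esub> mult_base n = mult_base (m + n)"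
proof -
  have "replicate_mset m base + replicate_mset n base = replicate_mset (m + n) base"
    by (simp add: multiset_eq_iff)
  then show ?thesis by (simp add: mult_base_def mult_S)
qed

lemma ple_S_mult_base: "ple (S_of \<Lambda>) (mult_base m) (mult_base n) \<longleftrightarrow> m \<le> n"
proof -
  have "ple (S_of \<Lambda>) a b \<longleftrightarrow> (\<exists>c\<in>carrier (S_of \<Lambda>). a \<otimes>\<^bsub>S_of \<Lambda>\<^esub> c = b)" for a b
    by (simp add: S_of_def monoid.defs algebraic_le_def)
  then show ?thesis
    by (auto simp: carrier_S_mult_base mult_S_mult_base mult_base_eq_iff le_iff_add)
qed

lemma stably_finite_case: "stably_finite (S_of \<Lambda>)"
  by (auto simp: stably_finite_def infinite_element_def carrier_S_mult_base one_S_mult_base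
      mult_S_mult_base mult_base_eq_iff)

lemma totally_ordered_case: "totally_ordered (S_of \<Lambda>)"
  unfolding totally_ordered_def order_on_defs
  by (auto simp: refl_on_def trans_def antisym_def total_on_def carrier_S_mult_base
      ple_S_mult_base mult_base_eq_iff)

end

end

theorem proposition6p3:
  fixes \<Lambda> :: "('a, 'k::finite) kgraph_data"
  assumes "k_graph \<Lambda>" and "row_finite \<Lambda>" and "no_sources \<Lambda>" and "cofinal_graph \<Lambda>"
    and "\<exists>\<alpha>. is_cycle \<Lambda> \<alpha> \<and> 1 \<le> deg \<Lambda> \<alpha>"
  shows "(stably_finite (S_of \<Lambda>) \<and> totally_ordered (S_of \<Lambda>)) \<or>
    (purely_infinite (S_of \<Lambda>) \<and>
     (\<forall>x\<in>carrier (S_of \<Lambda>). \<forall>y\<in>carrier (S_of \<Lambda>).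
        x \<noteq> \<one>\<^bsub>S_of \<Lambda>\<^esub> \<longrightarrow> y \<noteq> \<one>\<^bsub>S_of \<Lambda>\<^esub> \<longrightarrow> ple (S_of \<Lambda>) x y))"
proof -
  obtain \<gamma> where \<gamma>: "is_cycle \<Lambda> \<gamma>" "1 \<le> deg \<Lambda> \<gamma>" using assms(5) by blast
  interpret k_graph \<Lambda> by fact
  interpret cofinal_cyclic_k_graph \<Lambda> \<gamma>
    by unfold_locales (use assms(2-4) \<gamma> in auto)
  show ?thesis
  \<comment> \<open>The dichotomy is whether the cycle is the only path of its degree with range
    \<open>base\<close>.\<close>
  proof (cases "adj \<Lambda> (deg \<Lambda> \<gamma>) {#base#} = {#base#}")
    case True
    then show ?thesis using stably_finite_case totally_ordered_case by blast
  next
    case False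
    then show ?thesis using purely_infinite_case by blast
  qed
qed

end
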